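(* Let $\lambda$ be a nonzero real number and $a,b\in\mathbb{R}$. For all integers $n\ge0$, \[ \sum_{k=0}^{n}\binom{n}{k}\beta_{k,\lambda}^{(a)}(x)\,\mathcal{E}_{n-k,\lambda}^{(b-1)}(y)=\sum_{k=0}^{n}\binom{n}{k}\Big[\beta_{k,\lambda}^{(a)}(x)+\frac{k}{2}\beta_{k-1,\lambda}^{(a-1)}(x)\Big]\mathcal{E}_{n-k,\lambda}^{(b)}(y), \] where for $k=0$ the term $\frac{k}{2}\beta_{k-1,\lambda}^{(a-1)}(x)$ is interpreted as $0$.
   Context: For a nonzero real $\lambda$ and any $x$, set $(x)_{0,\lambda}=1$ and $(x)_{n,\lambda}=x(x-\lambda)\cdots(x-(n-1)\lambda)$ for $n\ge1$. The degenerate exponential is $e_{\lambda}^{x}(t)=\sum_{k\ge0}(x)_{k,\lambda}\frac{t^k}{k!}$ ($=(1+\lambda t)^{x/\lambda}$), $e_\lambda(t)=e_\lambda^1(t)$. For $\alpha\in\mathbb{R}$, $\beta_{n,\lambda}^{(\alpha)}(x)$ and $\mathcal{E}_{n,\lambda}^{(\alpha)}(x)$ are defined by $\left(\frac{t}{e_\lambda(t)-1}\right)^{\alpha}e_\lambda^x(t)=\sum_{n\ge0}\beta_{n,\lambda}^{(\alpha)}(x)\frac{t^n}{n!}$ and $\left(\frac{2}{e_\lambda(t)+1}\right)^{\alpha}e_\lambda^x(t)=\sum_{n\ge0}\mathcal{E}_{n,\lambda}^{(\alpha)}(x)\frac{t^n}{n!}$. *)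

theory Defs
  imports Complex_Main "HOL-Computational_Algebra.Formal_Power_Series"
begin

text \<open>
  The parameter \<open>\<lambda>\<close> and the orders are real; the arguments \<open>x\<close>, \<open>y\<close> range over an arbitrary
  field extension of the reals (in particular the real or the complex numbers). Generating
  functions are formal power series in \<open>t\<close> (= \<^term>\<open>fps_X\<close>).
\<close>

definition deg_falling :: "real \<Rightarrow> 'a::real_field \<Rightarrow> nat \<Rightarrow> 'a" where
  "deg_falling l x n = (\<Prod>i<n. x - of_nat i * of_real l)"

definition deg_exp :: "real \<Rightarrow> 'a::real_field \<Rightarrow> 'a fps" where
  "deg_exp l x = Abs_fps (\<lambda>k. deg_falling l x k / fact k)"

text \<open>
  Real power of a power series with constant term 1, by the binomial series
  \<open>f\<^sup>\<alpha> = (\<Sum>n. (\<alpha> gchoose n) (f - 1)\<^sup>n)\<close>. Composition is meaningful only if \<open>f - 1\<close> has zero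
  constant term; the lemmas \<open>bernoulli_base_0\<close> and \<open>euler_base_0\<close> below verify this for both uses.
\<close>

definition fps_real_power :: "'a::real_field fps \<Rightarrow> real \<Rightarrow> 'a fps" where
  "fps_real_power f \<alpha> = fps_compose (fps_binomial (of_real \<alpha>)) (f - 1)"

text \<open>
  Division of power series cancels the common factor \<open>t\<close> in \<open>t / (e\<^sub>\<lambda>(t) - 1)\<close>.
\<close>

definition deg_bernoulli :: "real \<Rightarrow> real \<Rightarrow> nat \<Rightarrow> 'a::real_field \<Rightarrow> 'a" where
  "deg_bernoulli l \<alpha> n x =
     fact n * fps_nth (fps_real_power (fps_X / (deg_exp l 1 - 1)) \<alpha> * deg_exp l x) n"

definition deg_euler :: "real \<Rightarrow> real \<Rightarrow> nat \<Rightarrow> 'a::real_field \<Rightarrow> 'a" where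
  "deg_euler l \<alpha> n x =
     fact n * fps_nth (fps_real_power (2 / (deg_exp l 1 + 1)) \<alpha> * deg_exp l x) n"

lemma deg_exp_nth_0: "fps_nth (deg_exp l x) 0 = 1"
  by (simp add: deg_exp_def deg_falling_def)

lemma deg_exp_nth_1: "fps_nth (deg_exp l x) (Suc 0) = x"
  by (simp add: deg_exp_def deg_falling_def)

lemma bernoulli_base_mult:
  "(fps_X / (deg_exp l 1 - 1)) * (deg_exp l 1 - 1) = (fps_X :: 'a::real_field fps)"
proof -
  have s: "subdegree (deg_exp l (1::'a) - 1) = 1"
    by (rule subdegreeI) (auto simp: deg_exp_nth_0 deg_exp_nth_1)
  then have "deg_exp l (1::'a) - 1 dvd fps_X"
    by (subst fps_dvd_iff) auto
  then show ?thesis by simp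
qed

lemma bernoulli_base_0: "fps_nth (fps_X / (deg_exp l 1 - 1) :: 'a::real_field fps) 0 = 1"
proof -
  have "fps_nth ((fps_X / (deg_exp l 1 - 1)) * (deg_exp l 1 - 1) :: 'a fps) 1 = 1"
    by (simp add: bernoulli_base_mult)
  then show ?thesis
    by (simp add: fps_mult_nth deg_exp_nth_0 deg_exp_nth_1)
qed

lemma euler_base_0: "fps_nth (2 / (deg_exp l 1 + 1) :: 'a::real_field fps) 0 = 1"
  by (simp add: fps_divide_unit deg_exp_nth_0 fps_numeral_nth)

end

theory Submission
  imports Defs
begin

text \<open>
  Write \<open>e = e\<^sub>\<lambda>(t)\<close>, \<open>B = t / (e - 1)\<close> and \<open>E = 2 / (e + 1)\<close>. Then
  \<open>t B\<^sup>a\<^sup>-\<^sup>1 = B\<^sup>a (e - 1)\<close> and \<open>2 E\<^sup>b\<^sup>-\<^sup>1 = E\<^sup>b (e + 1)\<close>, so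
  \<open>(B\<^sup>a + t/2 B\<^sup>a\<^sup>-\<^sup>1) E\<^sup>b = B\<^sup>a (e + 1)/2 E\<^sup>b = B\<^sup>a E\<^sup>b\<^sup>-\<^sup>1\<close>.
  Multiplying by \<open>e\<^sub>\<lambda>\<^sup>x(t) e\<^sub>\<lambda>\<^sup>y(t)\<close> and comparing coefficients gives the identity.
\<close>

text \<open>The binomial series obeys the exponent law with \<open>1 + fps_X\<close> as its first
  power. Composition with \<open>f - 1\<close> is multiplicative because the constant term vanishes,
  and it sends \<open>1 + fps_X\<close> to \<open>f\<close>.\<close>

lemma fps_real_power_diff_1_mult:
  fixes f :: "'a::real_field fps"
  assumes "fps_nth f 0 = 1"
  shows "fps_real_power f (\<alpha> - 1) * f = fps_real_power f \<alpha>"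
proof -
  have f0: "fps_nth (f - 1) 0 = 0"
    using assms by simp
  have "fps_binomial (of_real \<alpha>) = fps_binomial (of_real (\<alpha> - 1)) * (1 + fps_X :: 'a fps)"
    using fps_binomial_add_mult[of "of_real (\<alpha> - 1)" "1::'a"] by (simp add: fps_binomial_1)
  then show ?thesis
    by (simp add: fps_real_power_def fps_compose_mult_distrib[OF f0] fps_compose_add_distrib
        fps_X_fps_compose_startby0 assms)
qed

text \<open>Turns both sums of the theorem into coefficients of products of generating functions;
  the factorials absorb the binomial coefficient.\<close>

lemma sum_binomial_egf_mult:
  fixes F G :: "'a::field_char_0 fps"
  shows "(\<Sum>k=0..n. of_nat (n choose k) * (fact k * fps_nth F k) * (fact (n - k) * fps_nth G (n - k))) =
    fact n * fps_nth (F * G) n"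
  unfolding fps_mult_nth sum_distrib_left
proof (rule sum.cong)
  fix k assume "k \<in> {0..n}"
  then have "fact k * fact (n - k) * of_nat (n choose k) = (fact n :: 'a)"
    by (simp add: binomial_fact)
  then show "of_nat (n choose k) * (fact k * fps_nth F k) * (fact (n - k) * fps_nth G (n - k)) =
      fact n * (fps_nth F k * fps_nth G (n - k))"
    by (metis (no_types, lifting) mult.commute mult.left_commute)
qed simp

lemma fps_X_mult_bernoulli_power:
  "fps_X * fps_real_power (fps_X / (deg_exp l 1 - 1)) (a - 1) =
    fps_real_power (fps_X / (deg_exp l 1 - 1)) a * (deg_exp l 1 - 1 :: 'a::real_field fps)"
proof -
  let ?B = "fps_X / (deg_exp l 1 - 1) :: 'a fps"
  \<comment> \<open>One factor \<open>?B\<close> is split off to cancel against the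
    denominator.\<close>
  have "fps_real_power ?B a * (deg_exp l 1 - 1) =
      fps_real_power ?B (a - 1) * (?B * (deg_exp l 1 - 1))"
    by (simp only: mult.assoc flip: fps_real_power_diff_1_mult[where \<alpha>=a, OF bernoulli_base_0])
  then show ?thesis
    by (simp only: bernoulli_base_mult mult.commute[of fps_X])
qed

lemma two_mult_euler_power:
  "2 * fps_real_power (2 / (deg_exp l 1 + 1)) (b - 1) =
    fps_real_power (2 / (deg_exp l 1 + 1)) b * (deg_exp l 1 + 1 :: 'a::real_field fps)"
proof -
  let ?E = "2 / (deg_exp l 1 + 1) :: 'a fps"
  have "?E * (deg_exp l 1 + 1) = 2"
    by (simp add: fps_divide_unit deg_exp_nth_0 mult.assoc inverse_mult_eq_1)
  moreover have "fps_real_power ?E b * (deg_exp l 1 + 1) =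
      fps_real_power ?E (b - 1) * (?E * (deg_exp l 1 + 1))"
    by (simp only: mult.assoc flip: fps_real_power_diff_1_mult[where \<alpha>=b, OF euler_base_0])
  ultimately show ?thesis
    by (simp only: mult.commute)
qed

theorem theorem3p10:
  fixes l a b :: real and x y :: "'a::real_field" and n :: nat
  assumes "l \<noteq> 0"
  shows "(\<Sum>k=0..n. of_nat (n choose k) * deg_bernoulli l a k x * deg_euler l (b - 1) (n - k) y) =
    (\<Sum>k=0..n. of_nat (n choose k) *
       (deg_bernoulli l a k x +
        (if k = 0 then 0 else of_nat k / 2 * deg_bernoulli l (a - 1) (k - 1) x)) *
       deg_euler l b (n - k) y)"
proof -
  define B where "B \<alpha> = fps_real_power (fps_X / (deg_exp l 1 - 1) :: 'a fps) \<alpha>" for \<alpha>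
  define E where "E \<alpha> = fps_real_power (2 / (deg_exp l 1 + 1) :: 'a fps) \<alpha>" for \<alpha>
  define F where "F = B (a - 1) * deg_exp l x"
  \<comment> \<open>\<open>H\<close> generates the correction terms: \<open>fps_X\<close> shifts the
    index, \<open>fact k = k * fact (k - 1)\<close> yields the factor \<open>k\<close>, and the zero
    constant term matches the convention at \<open>k = 0\<close>.\<close>
  define H where "H = fps_const (1/2) * (fps_X * F)"
  have bracket: "deg_bernoulli l a k x +
        (if k = 0 then 0 else of_nat k / 2 * deg_bernoulli l (a - 1) (k - 1) x) =
      fact k * fps_nth (B a * deg_exp l x + H) k" for k
    by (cases k) (simp_all add: deg_bernoulli_def H_def distrib_left flip: B_def F_def)
  have "2 * (B a * deg_exp l x * (E (b - 1) * deg_exp l y)) =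
      B a * deg_exp l x * ((2 * E (b - 1)) * deg_exp l y)"
    by (simp add: algebra_simps)
  \<comment> \<open>Splits \<open>deg_exp l 1 + 1\<close> as \<open>2 + (deg_exp l 1 - 1)\<close>,
    so that the second part can meet the Bernoulli factor.\<close>
  also have "\<dots> = (2 * (B a * deg_exp l x) + B a * (deg_exp l 1 - 1) * deg_exp l x) * (E b * deg_exp l y)"
    unfolding E_def two_mult_euler_power by (simp add: algebra_simps)
  also have "B a * (deg_exp l 1 - 1) * deg_exp l x = 2 * H"
  proof -
    have "2 * H = (fps_const 2 * fps_const (1/2)) * (fps_X * F)"
      unfolding H_def by (simp only: mult.assoc numeral_fps_const)
    also have "\<dots> = fps_X * B (a - 1) * deg_exp l x"
      by (simp add: F_def mult.assoc)
    finally show ?thesis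
      by (simp add: B_def fps_X_mult_bernoulli_power)
  qed
  finally have "2 * (B a * deg_exp l x * (E (b - 1) * deg_exp l y)) =
      2 * ((B a * deg_exp l x + H) * (E b * deg_exp l y))"
    by (simp only: distrib_left distrib_right mult.assoc)
  then have "B a * deg_exp l x * (E (b - 1) * deg_exp l y) =
      (B a * deg_exp l x + H) * (E b * deg_exp l y)"
    by (simp only: mult_cancel_left) simp
  then show ?thesis
    unfolding bracket unfolding deg_bernoulli_def deg_euler_def
    by (simp only: sum_binomial_egf_mult B_def E_def)
qed

end
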